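(* Let $\mathcal{X}$ be a real or complex normed space and let $x, y \in \mathcal{X}$. If $x \perp_{SI} y$, then $x \perp_B^r y$. In particular, if $\mathcal{X}$ is a real normed space, then $x \perp_{SI} y$ implies $x \perp_B y$.
   Context: Let $\mathcal{X}$ be a normed space over $\mathbb{K} \in \{\mathbb{R}, \mathbb{C}\}$ and $x,y\in\mathcal{X}$. Birkhoff-James orthogonality: $x \perp_B y$ if $\|x\| \le \|x + \lambda y\|$ for all $\lambda \in \mathbb{K}$. r-orthogonality: $x \perp_B^r y$ if $\|x + \lambda y\| \ge \|x\|$ for all $\lambda \in \mathbb{R}$. Isosceles orthogonality: if $\mathbb{K} = \mathbb{R}$, $x \perp_I y$ means $\|x + y\| = \|x - y\|$; if $\mathbb{K} = \mathbb{C}$, $x \perp_I y$ means $\|x+y\| = \|x-y\|$ and $\|x + iy\| = \|x - iy\|$. Strong isosceles orthogonality: $x \perp_{SI} y$ if $x \perp_I y$ and there exists a real sequence $\{\lambda_n\}_{n \in \mathbb{N}}$ with $\lambda_n > 0$ for all $n$, $\lim_{n\to\infty} \lambda_n = 0$, and $x \perp_I \lambda_n y$ for all $n \in \mathbb{N}$. *)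

theory Defs
  imports "HOL-Analysis.Analysis"
begin

text \<open>
  A complex normed space is a real normed space with a compatible complex scalar
  multiplication; \<open>scaleR_scaleC\<close> makes \<open>r *\<^sub>R x\<close> the product of \<open>x\<close> with the real scalar
  \<open>r\<close> regarded as a complex number. The remaining unit law is \<open>scaleC_one\<close> below.
\<close>

class complex_normed_vector = real_normed_vector +
  fixes scaleC :: "complex \<Rightarrow> 'a \<Rightarrow> 'a" (infixr "*\<^sub>C" 75)
  assumes scaleC_add_right: "a *\<^sub>C (x + y) = a *\<^sub>C x + a *\<^sub>C y"
    and scaleC_add_left: "(a + b) *\<^sub>C x = a *\<^sub>C x + b *\<^sub>C x"
    and scaleC_scaleC: "a *\<^sub>C b *\<^sub>C x = (a * b) *\<^sub>C x"
    and scaleR_scaleC: "r *\<^sub>R x = complex_of_real r *\<^sub>C x"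
    and norm_scaleC: "norm (a *\<^sub>C x) = cmod a * norm x"

lemma scaleC_one: "1 *\<^sub>C x = (x :: 'a::complex_normed_vector)"
  using scaleR_scaleC[of 1 x] by simp

instantiation complex :: complex_normed_vector
begin

definition scaleC_complex :: "complex \<Rightarrow> complex \<Rightarrow> complex"
  where "scaleC_complex a x = a * x"

instance
  by standard (simp_all add: scaleC_complex_def algebra_simps scaleR_conv_of_real norm_mult)

end

text \<open>
  The scalar multiplication determines the scalar field in Birkhoff-James orthogonality:
  \<open>scaleR\<close> for real spaces, \<open>scaleC\<close> for complex spaces.
\<close>

definition birkhoff_james_orth ::
    "('k::real_normed_field \<Rightarrow> 'a::real_normed_vector \<Rightarrow> 'a) \<Rightarrow> 'a \<Rightarrow> 'a \<Rightarrow> bool"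
  where "birkhoff_james_orth smul x y \<longleftrightarrow> (\<forall>l::'k. norm x \<le> norm (x + smul l y))"

definition r_orth :: "'a::real_normed_vector \<Rightarrow> 'a \<Rightarrow> bool"
  where "r_orth x y \<longleftrightarrow> (\<forall>l::real. norm (x + l *\<^sub>R y) \<ge> norm x)"

definition isosceles_orth_real :: "'a::real_normed_vector \<Rightarrow> 'a \<Rightarrow> bool"
  where "isosceles_orth_real x y \<longleftrightarrow> norm (x + y) = norm (x - y)"

definition isosceles_orth_complex :: "'a::complex_normed_vector \<Rightarrow> 'a \<Rightarrow> bool"
  where "isosceles_orth_complex x y \<longleftrightarrow>
    norm (x + y) = norm (x - y) \<and> norm (x + \<i> *\<^sub>C y) = norm (x - \<i> *\<^sub>C y)"

definition strong_isosceles_orth_real :: "'a::real_normed_vector \<Rightarrow> 'a \<Rightarrow> bool"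
  where "strong_isosceles_orth_real x y \<longleftrightarrow>
    isosceles_orth_real x y \<and>
    (\<exists>l :: nat \<Rightarrow> real. (\<forall>n. l n > 0) \<and> l \<longlonglongrightarrow> 0 \<and>
      (\<forall>n. isosceles_orth_real x (l n *\<^sub>R y)))"

definition strong_isosceles_orth_complex :: "'a::complex_normed_vector \<Rightarrow> 'a \<Rightarrow> bool"
  where "strong_isosceles_orth_complex x y \<longleftrightarrow>
    isosceles_orth_complex x y \<and>
    (\<exists>l :: nat \<Rightarrow> real. (\<forall>n. l n > 0) \<and> l \<longlonglongrightarrow> 0 \<and>
      (\<forall>n. isosceles_orth_complex x (l n *\<^sub>R y)))"

end

theory Submission
  imports Defs
begin

text \<open>
  The function \<open>f t = norm (x + t *\<^sub>R y)\<close> is convex. If \<open>f a = f (- a)\<close> with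
  \<open>a > 0\<close>, then \<open>f 0 \<le> f a\<close>, and \<open>f a \<le> f t\<close> whenever \<open>\<bar>t\<bar> \<ge> a\<close>. Strong isosceles orthogonality
  supplies such \<open>a\<close> below any given \<open>\<bar>t\<bar> > 0\<close>.
\<close>

lemma norm_le_norm_add_scaleR_of_ge:
  fixes x y :: "'a::real_normed_vector"
  assumes eq: "norm (x + a *\<^sub>R y) = norm (x - a *\<^sub>R y)" and "0 < a" "a \<le> t"
  shows "norm x \<le> norm (x + t *\<^sub>R y)"
proof -
  let ?N = "norm (x + a *\<^sub>R y)"
  \<comment> \<open>\<open>x\<close> is the midpoint of \<open>x + a *\<^sub>R y\<close> and
    \<open>x - a *\<^sub>R y\<close>, which both have norm \<open>?N\<close>.\<close>
  have "2 * norm x = norm ((x + a *\<^sub>R y) + (x - a *\<^sub>R y))"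
    by (simp flip: scaleR_2)
  also have "\<dots> \<le> 2 * ?N"
    using norm_triangle_ineq[of "x + a *\<^sub>R y" "x - a *\<^sub>R y"] eq by simp
  finally have "norm x \<le> ?N" by simp
  \<comment> \<open>This writes \<open>x + a *\<^sub>R y\<close> as a convex combination of
    \<open>x - a *\<^sub>R y\<close> and \<open>x + t *\<^sub>R y\<close>, multiplied by
    \<open>t + a\<close> to clear denominators. The weight \<open>t - a\<close> is nonnegative
    because \<open>a \<le> t\<close>, so it comes out of the norm unchanged.\<close>
  have "(t + a) *\<^sub>R (x + a *\<^sub>R y) = (t - a) *\<^sub>R (x - a *\<^sub>R y) + (2 * a) *\<^sub>R (x + t *\<^sub>R y)"
    by (simp add: algebra_simps flip: scaleR_2)
  then have "norm ((t + a) *\<^sub>R (x + a *\<^sub>R y))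
      \<le> norm ((t - a) *\<^sub>R (x - a *\<^sub>R y)) + norm ((2 * a) *\<^sub>R (x + t *\<^sub>R y))"
    using norm_triangle_ineq by metis
  then have "(t + a) * ?N \<le> (t - a) * ?N + 2 * a * norm (x + t *\<^sub>R y)"
    using assms by simp
  then have "a * ?N \<le> a * norm (x + t *\<^sub>R y)"
    by (simp add: algebra_simps)
  then have "?N \<le> norm (x + t *\<^sub>R y)"
    using \<open>0 < a\<close> by simp
  with \<open>norm x \<le> ?N\<close> show ?thesis by simp
qed

lemma strong_isosceles_orth_real_imp_r_orth:
  assumes "strong_isosceles_orth_real x y"
  shows "r_orth x y"
  unfolding r_orth_def
proof
  fix t :: real
  obtain l :: "nat \<Rightarrow> real" where pos: "\<And>n. 0 < l n" and lim: "l \<longlonglongrightarrow> 0"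
    and eq: "\<And>n. norm (x + l n *\<^sub>R y) = norm (x - l n *\<^sub>R y)"
    using assms unfolding strong_isosceles_orth_real_def isosceles_orth_real_def by blast
  show "norm x \<le> norm (x + t *\<^sub>R y)"
  proof (cases "t = 0")
    case False
    then have "eventually (\<lambda>n. l n < \<bar>t\<bar>) sequentially"
      using order_tendstoD(2)[OF lim] by simp
    then obtain n where n: "l n < \<bar>t\<bar>"
      using eventually_happens'[OF sequentially_bot] by blast
    show ?thesis
    proof (cases "0 < t")
      case True
      then show ?thesis
        using norm_le_norm_add_scaleR_of_ge[OF eq[of n] pos[of n]] n by simp
    next
      case False
      \<comment> \<open>Replacing \<open>y\<close> by \<open>- y\<close> and \<open>t\<close> by
        \<open>- t\<close> keeps \<open>x + t *\<^sub>R y\<close> and swaps the two sides of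
        \<open>eq\<close>, so negative \<open>t\<close> reduces to the positive case.\<close>
      then show ?thesis
        using norm_le_norm_add_scaleR_of_ge[of x "l n" "- y" "- t"] eq[of n] pos[of n] n by simp
    qed
  qed simp
qed

text \<open>The same sequence serves as witness, since the first conjunct of complex isosceles
  orthogonality is the real one. This reduces the complex case to the real case.\<close>

lemma strong_isosceles_orth_complex_imp_real:
  "strong_isosceles_orth_complex u v \<Longrightarrow> strong_isosceles_orth_real u v"
  unfolding strong_isosceles_orth_complex_def strong_isosceles_orth_real_def
    isosceles_orth_complex_def isosceles_orth_real_def
  by blast

theorem theorem5p3:
  fixes x y :: "'a::real_normed_vector"
    and u v :: "'b::complex_normed_vector"
  shows "(strong_isosceles_orth_real x y \<longrightarrow> r_orth x y)
    \<and> (strong_isosceles_orth_complex u v \<longrightarrow> r_orth u v)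
    \<and> (strong_isosceles_orth_real x y \<longrightarrow> birkhoff_james_orth scaleR x y)"
proof -
  \<comment> \<open>With \<open>scaleR\<close> the scalar type is \<open>real\<close>, so both sides
    quantify over the same scalars.\<close>
  have "birkhoff_james_orth scaleR x y \<longleftrightarrow> r_orth x y"
    by (simp add: birkhoff_james_orth_def r_orth_def)
  then show ?thesis
    by (simp add: strong_isosceles_orth_real_imp_r_orth strong_isosceles_orth_complex_imp_real)
qed

end
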